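(* Let $n,d\ge1$. For any polynomial $f=\sum_{\beta\in I(n,d)}f_\beta x^\beta\in\mathcal{H}_{n,d}$ and any integer $r\ge1$, one has $$\max_{x\in\Delta_n}\{B_r(f)(x)-f(x)\}\le\left(1-\frac{r^{\underline{d}}}{r^d}\right)\left(\max_{\beta\in I(n,d)}f_\beta\frac{\beta!}{d!}-\min_{\beta\in I(n,d)}f_\beta\frac{\beta!}{d!}\right)\le\left(1-\frac{r^{\underline{d}}}{r^d}\right)\binom{2d-1}{d}d^d(\overline{f}-\underline{f}).$$
   Context: $\mathbb{N}=\{0,1,2,\dots\}$. $\mathcal{H}_{n,d}$ is the set of homogeneous polynomials of degree $d$ in $n$ variables with real coefficients. The standard simplex is $\Delta_n=\{x\in\mathbb{R}_+^n:\sum_{i=1}^n x_i=1\}$; $\underline{f}=\min_{x\in\Delta_n}f(x)$ and $\overline{f}=\max_{x\in\Delta_n}f(x)$. The falling factorial is $r^{\underline{d}}=r(r-1)\cdots(r-d+1)$ (so $r^{\underline{d}}=0$ if $r<d$). For $r\ge 0$, $I(n,r)=\{\alpha\in\mathbb{N}^n:\sum_{i=1}^n\alpha_i=r\}$. For $\alpha\in\mathbb{N}^n$, $\alpha!=\prod_{i=1}^n\alpha_i!$ and $x^\alpha=\prod_{i=1}^n x_i^{\alpha_i}$ (with $0^0=1$). The Bernstein approximation of order $r\ge1$ on the simplex of a polynomial $f$ is the polynomial $$B_r(f)(x)=\sum_{\alpha\in I(n,r)}f\left(\frac{\alpha}{r}\right)\frac{r!}{\alpha!}x^\alpha.$$ 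*)

theory Defs
  imports "HOL-Analysis.Analysis" "HOL-Library.Poly_Mapping"
begin

text \<open>
  Real polynomials in the variables \<open>x\<^sub>i\<close>, \<open>i :: 'n\<close>, are finitely supported maps from exponent
  vectors to coefficients, i.e. elements of the monoid ring of the additive monoid
  \<^typ>\<open>nat ^ 'n\<close>. The number of variables is \<open>CARD('n)\<close>.
\<close>

type_synonym 'n mpoly_real = "(nat ^ 'n) \<Rightarrow>\<^sub>0 real"

definition vec_monom :: "real ^ 'n \<Rightarrow> nat ^ 'n \<Rightarrow> real" where
  "vec_monom x \<alpha> = (\<Prod>i\<in>UNIV. (x $ i) ^ (\<alpha> $ i))"

definition mfact :: "nat ^ 'n \<Rightarrow> real" where
  "mfact \<alpha> = (\<Prod>i\<in>UNIV. fact (\<alpha> $ i))"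

definition multi_indices :: "nat \<Rightarrow> (nat ^ 'n) set" where
  "multi_indices r = {\<alpha>. (\<Sum>i\<in>UNIV. \<alpha> $ i) = r}"

definition peval :: "'n::finite mpoly_real \<Rightarrow> real ^ 'n \<Rightarrow> real" where
  "peval f x = (\<Sum>\<beta>\<in>Poly_Mapping.keys f. Poly_Mapping.lookup f \<beta> * vec_monom x \<beta>)"

text \<open>As usual, the zero polynomial is homogeneous of every degree.\<close>

definition homogeneous_polys :: "nat \<Rightarrow> 'n::finite mpoly_real set" where
  "homogeneous_polys d = {f. Poly_Mapping.keys f \<subseteq> multi_indices d}"

definition std_simplex :: "(real ^ 'n) set" where
  "std_simplex = {x. (\<forall>i. 0 \<le> x $ i) \<and> (\<Sum>i\<in>UNIV. x $ i) = 1}"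

text \<open>
  \<^const>\<open>Max\<close> and \<^const>\<open>Min\<close> are unspecified on infinite sets, so maxima and minima over the
  simplex are the greatest and least element of the image. They exist for continuous functions,
  see below.
\<close>

definition simplex_max :: "(real ^ 'n \<Rightarrow> real) \<Rightarrow> real" where
  "simplex_max g = (GREATEST v. v \<in> g ` std_simplex)"

definition simplex_min :: "(real ^ 'n \<Rightarrow> real) \<Rightarrow> real" where
  "simplex_min g = (LEAST v. v \<in> g ` std_simplex)"

definition falling_fact :: "nat \<Rightarrow> nat \<Rightarrow> real" where
  "falling_fact r d = (\<Prod>i<d. real r - real i)"

definition bernstein_approx :: "nat \<Rightarrow> 'n::finite mpoly_real \<Rightarrow> real ^ 'n \<Rightarrow> real" where
  "bernstein_approx r f x =
     (\<Sum>\<alpha>\<in>multi_indices r.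
        peval f (\<chi> i. real (\<alpha> $ i) / real r) * (fact r / mfact \<alpha>) * vec_monom x \<alpha>)"

text \<open>The maxima, minima and sums above range over finite or compact nonempty sets.\<close>

lemma finite_multi_indices: "finite (multi_indices r :: (nat ^ 'n) set)"
proof -
  have "multi_indices r \<subseteq> (\<lambda>g. \<chi> i. g i) ` (Pi\<^sub>E (UNIV :: 'n set) (\<lambda>_. {..r}))"
  proof
    fix \<alpha> :: "nat ^ 'n"
    assume "\<alpha> \<in> multi_indices r"
    then have "\<alpha> $ i \<le> r" for i
      unfolding multi_indices_def
      using member_le_sum[of i UNIV "\<lambda>i. \<alpha> $ i"] by auto
    then show "\<alpha> \<in> (\<lambda>g. \<chi> i. g i) ` (Pi\<^sub>E UNIV (\<lambda>_. {..r}))"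
      by (intro image_eqI[where x = "\<lambda>i. \<alpha> $ i"]) auto
  qed
  then show ?thesis
    by (rule finite_subset) (intro finite_imageI finite_PiE; simp)
qed

lemma multi_indices_nonempty: "(multi_indices r :: (nat ^ 'n) set) \<noteq> {}"
proof -
  obtain k :: 'n where True by simp
  have "(\<chi> i. if i = k then r else 0) \<in> (multi_indices r :: (nat ^ 'n) set)"
    by (simp add: multi_indices_def)
  then show ?thesis by blast
qed

lemma std_simplex_nonempty: "(std_simplex :: (real ^ 'n) set) \<noteq> {}"
proof -
  obtain k :: 'n where True by simp
  have "(\<chi> i. if i = k then 1 else 0) \<in> (std_simplex :: (real ^ 'n) set)"
    by (simp add: std_simplex_def)
  then show ?thesis by blast
qed

lemma compact_std_simplex: "compact (std_simplex :: (real ^ 'n) set)"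
proof -
  have le: "x $ i \<le> 1" if "x \<in> std_simplex" for x :: "real ^ 'n" and i
    using that member_le_sum[of i UNIV "\<lambda>i. x $ i"] by (auto simp: std_simplex_def)
  have eq: "std_simplex = cbox 0 1 \<inter> {x :: real ^ 'n. (\<Sum>i\<in>UNIV. x $ i) = 1}"
    using le by (auto simp: std_simplex_def mem_box_cart)
  have "closed {x :: real ^ 'n. (\<Sum>i\<in>UNIV. x $ i) = 1}"
    by (intro closed_Collect_eq continuous_intros)
  then show ?thesis
    unfolding eq by (intro compact_Int_closed compact_cbox)
qed

lemma simplex_max_attained:
  fixes g :: "real ^ 'n \<Rightarrow> real"
  assumes "continuous_on std_simplex g"
  obtains x where "x \<in> std_simplex" "g x = simplex_max g" "\<forall>y\<in>std_simplex. g y \<le> g x"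
proof -
  obtain x where x: "x \<in> std_simplex" "\<forall>y\<in>std_simplex. g y \<le> g x"
    using continuous_attains_sup[OF compact_std_simplex std_simplex_nonempty assms] by blast
  then have "simplex_max g = g x"
    unfolding simplex_max_def by (intro Greatest_equality) auto
  with x that show thesis by metis
qed

lemma simplex_min_attained:
  fixes g :: "real ^ 'n \<Rightarrow> real"
  assumes "continuous_on std_simplex g"
  obtains x where "x \<in> std_simplex" "g x = simplex_min g" "\<forall>y\<in>std_simplex. g x \<le> g y"
proof -
  obtain x where x: "x \<in> std_simplex" "\<forall>y\<in>std_simplex. g x \<le> g y"
    using continuous_attains_inf[OF compact_std_simplex std_simplex_nonempty assms] by blast
  then have "simplex_min g = g x"
    unfolding simplex_min_def by (intro Least_equality) auto
  with x that show thesis by metis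
qed

lemma continuous_on_peval [continuous_intros]: "continuous_on S (peval f)"
  unfolding peval_def vec_monom_def by (intro continuous_intros)

lemma continuous_on_bernstein_approx [continuous_intros]:
  "continuous_on S (bernstein_approx r f)"
  unfolding bernstein_approx_def vec_monom_def by (intro continuous_intros)

end

theory Submission
  imports Defs
begin

text \<open>
  Write \<open>b\<^sub>\<beta> = f\<^sub>\<beta> \<beta>! / d!\<close>, so that \<open>f x = (\<Sum>\<beta>. b\<^sub>\<beta> (d! / \<beta>!) x\<^sup>\<beta>)\<close>. By the multinomial theorem the weights
  \<open>(d! / \<beta>!) x\<^sup>\<beta>\<close> sum to \<open>1\<close> on the simplex, hence \<open>f\<close> takes values between the least and the
  greatest \<open>b\<^sub>\<beta>\<close> there.

  \<^emph>\<open>The error.\<close> The value \<open>B\<^sub>r(f)(x)\<close> is the expectation of \<open>f (\<alpha> / r)\<close> when \<open>\<alpha>\<close> counts the outcomes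
  of \<open>r\<close> independent draws from the distribution \<open>x\<close>. The form \<open>r\<^sup>d f (\<alpha> / r)\<close> is the sum of
  \<open>b\<^sub>\<beta> (d! / \<beta>!) \<alpha>\<^sup>\<beta>\<close>. If the powers in \<open>\<alpha>\<^sup>\<beta>\<close> are replaced by falling factorials, the expectation
  becomes \<open>r (r - 1) \<dots> (r - d + 1) f x\<close> exactly, because factorial moments of the multinomial
  distribution are multiples of monomials (\<open>multinomial_factorial_moment\<close>). The replacement lowers every
  weight \<open>(d! / \<beta>!) \<alpha>\<^sup>\<beta>\<close>, and by the Vandermonde identity it lowers their total from \<open>r\<^sup>d\<close> to
  \<open>r (r - 1) \<dots> (r - d + 1)\<close>; so it costs at most the difference of these numbers times the greatest
  \<open>b\<^sub>\<beta>\<close> (\<open>peval_grid_le\<close>). Dividing by \<open>r\<^sup>d\<close> shows that \<open>B\<^sub>r(f)(x)\<close> is at most a convex combination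
  of \<open>f x\<close> and the greatest \<open>b\<^sub>\<beta>\<close> (\<open>bernstein_approx_le\<close>).

  \<^emph>\<open>The range of the coefficients.\<close> The mixed finite difference of order \<open>\<beta>\<close> at the origin kills all
  monomials of degree \<open>d\<close> except \<open>x\<^sup>\<beta>\<close>. This writes \<open>\<beta>! f\<^sub>\<beta>\<close> as a signed sum, with binomial weights, of
  the values of \<open>f\<close> at the integer points \<open>\<gamma> \<le> \<beta>\<close> (\<open>coefficient_from_grid_values\<close>). By homogeneity
  each such value is \<open>t\<^sup>d\<close> times a value on the simplex, where \<open>t \<le> d\<close> is the sum of the entries of
  \<open>\<gamma>\<close>. The weights of the nonzero \<open>\<gamma>\<close> have total \<open>2\<^sup>d - 1\<close>, which is at most \<open>(2 d - 1) choose d\<close>.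
  Applied to \<open>f - c (\<Sum>i. x\<^sub>i)\<^sup>d\<close> with \<open>c\<close> the midpoint of the range of \<open>f\<close>, this bounds every
  \<open>\<bar>b\<^sub>\<beta> - c\<bar>\<close>, and two such bounds give the range of the coefficients
  (\<open>bernstein_coeff_deviation\<close>).
\<close>

section \<open>Sums over multi-indices\<close>

lemma prod_add_axis:
  fixes q :: "'n::finite \<Rightarrow> nat \<Rightarrow> real" and \<gamma> :: "nat ^ 'n"
  assumes "q k (Suc (\<gamma> $ k)) = c * q k (\<gamma> $ k)"
  shows "(\<Prod>i\<in>UNIV. q i ((\<gamma> + axis k 1) $ i)) = c * (\<Prod>i\<in>UNIV. q i (\<gamma> $ i))"
proof -
  have "(\<Prod>i\<in>UNIV - {k}. q i ((\<gamma> + axis k 1) $ i)) = (\<Prod>i\<in>UNIV - {k}. q i (\<gamma> $ i))"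
    by (intro prod.cong) (auto simp: axis_def)
  then show ?thesis
    using assms by (simp add: prod.remove[of UNIV k] axis_def)
qed

lemma mfact_add_axis: "mfact (\<gamma> + axis k 1) = real (Suc (\<gamma> $ k)) * mfact \<gamma>"
  unfolding mfact_def by (rule prod_add_axis[where q = "\<lambda>_. fact"]) simp

lemma mfact_pos: "0 < mfact \<beta>"
  unfolding mfact_def by (intro prod_pos) simp

lemma vec_monom_nonneg: "(\<And>i. 0 \<le> x $ i) \<Longrightarrow> 0 \<le> vec_monom x \<beta>"
  unfolding vec_monom_def by (intro prod_nonneg) simp

lemma multi_indices_Suc_pos_image:
  fixes k :: "'n::finite"
  shows "{\<beta> \<in> multi_indices (Suc d). \<beta> $ k \<noteq> 0} = (\<lambda>\<gamma>. \<gamma> + axis k 1) ` multi_indices d"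
proof (intro set_eqI iffI)
  fix \<beta> :: "nat ^ 'n"
  assume \<beta>: "\<beta> \<in> {\<beta> \<in> multi_indices (Suc d). \<beta> $ k \<noteq> 0}"
  define \<gamma> :: "nat ^ 'n" where "\<gamma> = (\<chi> i. if i = k then \<beta> $ i - 1 else \<beta> $ i)"
  have eq: "\<beta> = \<gamma> + axis k 1"
    using \<beta> by (auto simp: vec_eq_iff \<gamma>_def axis_def)
  have "(\<Sum>i\<in>UNIV. \<beta> $ i) = (\<Sum>i\<in>UNIV. \<gamma> $ i) + 1"
    by (simp add: eq sum.distrib axis_def)
  then have "\<gamma> \<in> multi_indices d"
    using \<beta> by (simp add: multi_indices_def)
  with eq show "\<beta> \<in> (\<lambda>\<gamma>. \<gamma> + axis k 1) ` multi_indices d" by blast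
qed (auto simp: multi_indices_def sum.distrib axis_def)

text \<open>
  The Pascal recurrence for multinomial coefficients, in summed form: since the entries of \<open>\<beta>\<close> add
  up to \<open>d + 1\<close>, the factor \<open>d + 1\<close> of \<open>(d + 1)!\<close> distributes over the coordinates, and in coordinate
  \<open>k\<close> it lowers \<open>\<beta> $ k\<close> by one.
\<close>

lemma multinomial_sum_Suc:
  fixes h :: "nat ^ 'n::finite \<Rightarrow> real"
  shows "(\<Sum>\<beta>\<in>multi_indices (Suc d). fact (Suc d) / mfact \<beta> * h \<beta>)
       = (\<Sum>k\<in>UNIV. \<Sum>\<beta>\<in>multi_indices d. fact d / mfact \<beta> * h (\<beta> + axis k 1))"
proof -
  have "(\<Sum>\<beta>\<in>multi_indices (Suc d). fact (Suc d) / mfact \<beta> * h \<beta>)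
      = (\<Sum>\<beta>\<in>multi_indices (Suc d). \<Sum>k\<in>UNIV. real (\<beta> $ k) * (fact d / mfact \<beta> * h \<beta>))"
  proof (intro sum.cong refl)
    fix \<beta> :: "nat ^ 'n" assume "\<beta> \<in> multi_indices (Suc d)"
    then have "(\<Sum>k\<in>UNIV. real (\<beta> $ k)) = real (Suc d)"
      unfolding multi_indices_def by (metis (mono_tags) mem_Collect_eq of_nat_sum)
    then show "fact (Suc d) / mfact \<beta> * h \<beta>
        = (\<Sum>k\<in>UNIV. real (\<beta> $ k) * (fact d / mfact \<beta> * h \<beta>))"
      by (simp only: sum_distrib_right[symmetric] fact_Suc) simp
  qed
  also have "\<dots> = (\<Sum>k\<in>UNIV. \<Sum>\<beta>\<in>multi_indices (Suc d). real (\<beta> $ k) * (fact d / mfact \<beta> * h \<beta>))"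
    by (rule sum.swap)
  also have "\<dots> = (\<Sum>k\<in>UNIV. \<Sum>\<beta>\<in>multi_indices d. fact d / mfact \<beta> * h (\<beta> + axis k 1))"
  proof (rule sum.cong[OF refl])
    fix k :: 'n
    let ?F = "\<lambda>\<beta> :: nat ^ 'n. real (\<beta> $ k) * (fact d / mfact \<beta> * h \<beta>)"
    have "sum ?F (multi_indices (Suc d)) = sum ?F {\<beta> \<in> multi_indices (Suc d). \<beta> $ k \<noteq> 0}"
      by (intro sum.mono_neutral_right) (auto simp: finite_multi_indices)
    also have "\<dots> = (\<Sum>\<gamma>\<in>multi_indices d. ?F (\<gamma> + axis k 1))"
      unfolding multi_indices_Suc_pos_image by (subst sum.reindex) (auto intro: inj_onI)
    also have "\<dots> = (\<Sum>\<beta>\<in>multi_indices d. fact d / mfact \<beta> * h (\<beta> + axis k 1))"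
    proof (intro sum.cong refl)
      fix \<gamma> :: "nat ^ 'n"
      have "(\<gamma> + axis k 1) $ k = Suc (\<gamma> $ k)" by (simp add: axis_def)
      then show "?F (\<gamma> + axis k 1) = fact d / mfact \<gamma> * h (\<gamma> + axis k 1)"
        using mfact_pos[of \<gamma>] by (simp only: mfact_add_axis) simp
    qed
    finally show "sum ?F (multi_indices (Suc d))
        = (\<Sum>\<beta>\<in>multi_indices d. fact d / mfact \<beta> * h (\<beta> + axis k 1))" .
  qed
  finally show ?thesis .
qed

text \<open>
  The products \<open>y (y - s) (y - 2 s) \<dots>\<close> are of binomial type for every step \<open>s\<close>. Step \<open>0\<close> gives the
  multinomial theorem and step \<open>1\<close> the Vandermonde identity. In the induction, the coordinate \<open>k\<close>
  contributes the new factor \<open>y $ k - s * \<beta> $ k\<close>, and these add up to the new factor on the right.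
\<close>

lemma multinomial_theorem_stepped:
  fixes y :: "real ^ 'n::finite"
  shows "(\<Sum>\<beta>\<in>multi_indices d. fact d / mfact \<beta> * (\<Prod>i\<in>UNIV. \<Prod>j<\<beta> $ i. y $ i - s * real j))
       = (\<Prod>j<d. (\<Sum>i\<in>UNIV. y $ i) - s * real j)"
proof (induction d)
  case 0
  have "multi_indices 0 = {0 :: nat ^ 'n}"
    by (auto simp: multi_indices_def vec_eq_iff)
  then show ?case by (simp add: mfact_def)
next
  case (Suc d)
  define P where "P \<beta> = (\<Prod>i\<in>UNIV. \<Prod>j<\<beta> $ i. y $ i - s * real j)" for \<beta> :: "nat ^ 'n"
  have P: "P (\<beta> + axis k 1) = (y $ k - s * real (\<beta> $ k)) * P \<beta>" for \<beta> k
    unfolding P_def by (rule prod_add_axis[where q = "\<lambda>i m. \<Prod>j<m. y $ i - s * real j"]) simp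
  have "(\<Sum>\<beta>\<in>multi_indices (Suc d). fact (Suc d) / mfact \<beta> * P \<beta>)
      = (\<Sum>\<beta>\<in>multi_indices d. \<Sum>k\<in>UNIV. fact d / mfact \<beta> * P (\<beta> + axis k 1))"
    by (subst multinomial_sum_Suc) (rule sum.swap)
  also have "\<dots> = (\<Sum>\<beta>\<in>multi_indices d. fact d / mfact \<beta> * P \<beta> * ((\<Sum>i\<in>UNIV. y $ i) - s * real d))"
  proof (intro sum.cong refl)
    fix \<beta> :: "nat ^ 'n" assume "\<beta> \<in> multi_indices d"
    then have "(\<Sum>k\<in>UNIV. real (\<beta> $ k)) = real d"
      unfolding multi_indices_def by (metis (mono_tags) mem_Collect_eq of_nat_sum)
    then have eq: "(\<Sum>i\<in>UNIV. y $ i) - s * real d = (\<Sum>k\<in>UNIV. y $ k - s * real (\<beta> $ k))"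
      by (simp add: sum_subtractf sum_distrib_left[symmetric])
    show "(\<Sum>k\<in>UNIV. fact d / mfact \<beta> * P (\<beta> + axis k 1))
        = fact d / mfact \<beta> * P \<beta> * ((\<Sum>i\<in>UNIV. y $ i) - s * real d)"
      unfolding eq P sum_distrib_left by (simp only: mult_ac)
  qed
  also have "\<dots> = (\<Prod>j<Suc d. (\<Sum>i\<in>UNIV. y $ i) - s * real j)"
    using Suc.IH unfolding P_def[symmetric] sum_distrib_right[symmetric]
    by (simp only: prod.lessThan_Suc)
  finally show ?case by (simp add: P_def)
qed

lemma multinomial_theorem:
  fixes y :: "real ^ 'n::finite"
  shows "(\<Sum>\<beta>\<in>multi_indices d. fact d / mfact \<beta> * vec_monom y \<beta>) = (\<Sum>i\<in>UNIV. y $ i) ^ d"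
  using multinomial_theorem_stepped[of d y 0] by (simp add: vec_monom_def)

section \<open>Falling factorials of multi-indices\<close>

definition vec_falling :: "nat ^ 'n \<Rightarrow> nat ^ 'n \<Rightarrow> real" where
  "vec_falling \<alpha> \<beta> = (\<Prod>i\<in>UNIV. falling_fact (\<alpha> $ i) (\<beta> $ i))"

lemma falling_fact_eq_0: "r < d \<Longrightarrow> falling_fact r d = 0"
  unfolding falling_fact_def by (rule prod_zero) auto

lemma falling_fact_nonneg: "0 \<le> falling_fact r d"
proof (cases "r < d")
  case False
  then show ?thesis unfolding falling_fact_def by (intro prod_nonneg) auto
qed (simp add: falling_fact_eq_0)

lemma falling_fact_le_power: "falling_fact r d \<le> real r ^ d"
proof (cases "r < d")
  case False
  then have "(\<Prod>i<d. real r - real i) \<le> (\<Prod>i<d. real r)"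
    by (intro prod_mono) auto
  then show ?thesis by (simp add: falling_fact_def)
qed (simp add: falling_fact_eq_0)

lemma falling_fact_add: "falling_fact (m + k) k * fact m = fact (m + k)"
proof (induction k)
  case (Suc k)
  have step: "falling_fact (Suc (m + k)) (Suc k) = real (Suc (m + k)) * falling_fact (m + k) k"
    unfolding falling_fact_def by (simp add: prod.lessThan_Suc_shift del: prod.lessThan_Suc)
  show ?case by (simp only: add_Suc_right step mult.assoc Suc.IH fact_Suc)
qed (simp add: falling_fact_def)

text \<open>
  It matters here that \<open>\<alpha>\<close> is integral: at real points falling factorials can change sign.
\<close>

lemma vec_falling_le_vec_monom: "vec_falling \<alpha> \<beta> \<le> vec_monom (\<chi> i. real (\<alpha> $ i)) \<beta>"
  unfolding vec_falling_def vec_monom_def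
  by (intro prod_mono) (simp add: falling_fact_nonneg falling_fact_le_power)

lemma vec_falling_nonzero_imp_le:
  assumes "vec_falling \<alpha> \<beta> \<noteq> 0"
  shows "\<beta> $ i \<le> \<alpha> $ i"
proof (rule ccontr)
  assume "\<not> ?thesis"
  then have "vec_falling \<alpha> \<beta> = 0"
    unfolding vec_falling_def by (intro prod_zero bexI[of _ i]) (auto simp: falling_fact_eq_0)
  with assms show False ..
qed

lemma multinomial_vandermonde:
  fixes \<alpha> :: "nat ^ 'n::finite"
  assumes "\<alpha> \<in> multi_indices r"
  shows "(\<Sum>\<beta>\<in>multi_indices d. fact d / mfact \<beta> * vec_falling \<alpha> \<beta>) = falling_fact r d"
proof -
  have "(\<Sum>i\<in>UNIV. real (\<alpha> $ i)) = real r"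
    using assms unfolding multi_indices_def by (metis (mono_tags) mem_Collect_eq of_nat_sum)
  then show ?thesis
    using multinomial_theorem_stepped[of d "\<chi> i. real (\<alpha> $ i)" 1]
    by (simp add: vec_falling_def falling_fact_def)
qed

text \<open>
  The factorial moments of the multinomial distribution. Where it does not vanish, the falling
  factorial cancels \<open>\<alpha>!\<close> down to \<open>(\<alpha> - \<beta>)!\<close>, and \<open>\<alpha> - \<beta>\<close> then runs through all multi-indices of
  size \<open>r - d\<close>, whose multinomial weights add up to \<open>1\<close>.
\<close>

lemma multinomial_factorial_moment:
  fixes x :: "real ^ 'n::finite"
  assumes x: "(\<Sum>i\<in>UNIV. x $ i) = 1" and \<beta>: "\<beta> \<in> multi_indices d"
  shows "(\<Sum>\<alpha>\<in>multi_indices r. fact r / mfact \<alpha> * vec_monom x \<alpha> * vec_falling \<alpha> \<beta>)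
       = falling_fact r d * vec_monom x \<beta>"
proof -
  let ?F = "\<lambda>\<alpha>. fact r / mfact \<alpha> * vec_monom x \<alpha> * vec_falling \<alpha> \<beta>"
  let ?U = "{\<alpha> \<in> multi_indices r. \<forall>i. \<beta> $ i \<le> \<alpha> $ i}"
  have sum\<beta>: "(\<Sum>i\<in>UNIV. \<beta> $ i) = d"
    using \<beta> by (simp add: multi_indices_def)
  have restrict: "sum ?F (multi_indices r) = sum ?F ?U"
    by (intro sum.mono_neutral_right)
       (auto simp: finite_multi_indices intro: vec_falling_nonzero_imp_le)
  show ?thesis
  proof (cases "r < d")
    case True
    have "?U = {}"
    proof (rule ccontr)
      assume "?U \<noteq> {}"
      then obtain \<alpha> where \<alpha>: "\<alpha> \<in> multi_indices r" "\<And>i. \<beta> $ i \<le> \<alpha> $ i" by auto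
      have "(\<Sum>i\<in>UNIV. \<beta> $ i) \<le> (\<Sum>i\<in>UNIV. \<alpha> $ i)"
        by (intro sum_mono \<alpha>)
      with True sum\<beta> \<alpha>(1) show False by (simp add: multi_indices_def)
    qed
    with True restrict show ?thesis by (simp only: falling_fact_eq_0) simp
  next
    case False
    have U: "?U = (\<lambda>\<gamma>. \<gamma> + \<beta>) ` multi_indices (r - d)"
    proof (intro set_eqI iffI)
      fix \<alpha> assume \<alpha>: "\<alpha> \<in> ?U"
      define \<gamma> :: "nat ^ 'n" where "\<gamma> = (\<chi> i. \<alpha> $ i - \<beta> $ i)"
      have eq: "\<alpha> = \<gamma> + \<beta>" using \<alpha> by (auto simp: \<gamma>_def vec_eq_iff)
      have "(\<Sum>i\<in>UNIV. \<alpha> $ i) = (\<Sum>i\<in>UNIV. \<gamma> $ i) + d"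
        by (simp add: eq sum.distrib sum\<beta>)
      then have "\<gamma> \<in> multi_indices (r - d)"
        using \<alpha> by (auto simp: multi_indices_def)
      with eq show "\<alpha> \<in> (\<lambda>\<gamma>. \<gamma> + \<beta>) ` multi_indices (r - d)" by blast
    qed (use False in \<open>auto simp: multi_indices_def sum.distrib sum\<beta>\<close>)
    have fr: "falling_fact r d * fact (r - d) = fact r"
      using False falling_fact_add[of "r - d" d] by simp
    have F: "?F (\<gamma> + \<beta>) = falling_fact r d * vec_monom x \<beta> * (fact (r - d) / mfact \<gamma> * vec_monom x \<gamma>)"
      for \<gamma>
    proof -
      have "vec_falling (\<gamma> + \<beta>) \<beta> * mfact \<gamma> = mfact (\<gamma> + \<beta>)"
        unfolding vec_falling_def mfact_def prod.distrib[symmetric]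
        by (simp add: falling_fact_add)
      then have falling: "vec_falling (\<gamma> + \<beta>) \<beta> = mfact (\<gamma> + \<beta>) / mfact \<gamma>"
        using mfact_pos[of \<gamma>] by (simp add: eq_divide_eq)
      have monom: "vec_monom x (\<gamma> + \<beta>) = vec_monom x \<gamma> * vec_monom x \<beta>"
        by (simp add: vec_monom_def power_add prod.distrib)
      show ?thesis
        unfolding falling monom fr[symmetric] using mfact_pos[of "\<gamma> + \<beta>"] by simp
    qed
    have "sum ?F ?U = (\<Sum>\<gamma>\<in>multi_indices (r - d). ?F (\<gamma> + \<beta>))"
      unfolding U by (subst sum.reindex) (auto intro: inj_onI)
    also have "\<dots> = falling_fact r d * vec_monom x \<beta>"
      by (simp only: F sum_distrib_left[symmetric] multinomial_theorem x) simp
    finally show ?thesis using restrict by simp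
  qed
qed

section \<open>The error of the Bernstein approximation\<close>

definition bernstein_coeff :: "nat \<Rightarrow> 'n::finite mpoly_real \<Rightarrow> nat ^ 'n \<Rightarrow> real" where
  "bernstein_coeff d f \<beta> = Poly_Mapping.lookup f \<beta> * (mfact \<beta> / fact d)"

lemma peval_homogeneous:
  assumes "f \<in> homogeneous_polys d"
  shows "peval f x = (\<Sum>\<beta>\<in>multi_indices d. Poly_Mapping.lookup f \<beta> * vec_monom x \<beta>)"
  using assms unfolding peval_def homogeneous_polys_def
  by (intro sum.mono_neutral_left) (auto simp: finite_multi_indices in_keys_iff)

lemma peval_bernstein_form:
  fixes f :: "'n::finite mpoly_real"
  assumes "f \<in> homogeneous_polys d"
  shows "peval f x
       = (\<Sum>\<beta>\<in>multi_indices d. bernstein_coeff d f \<beta> * (fact d / mfact \<beta> * vec_monom x \<beta>))"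
  unfolding peval_homogeneous[OF assms] bernstein_coeff_def
proof (intro sum.cong refl)
  fix \<beta> :: "nat ^ 'n"
  show "Poly_Mapping.lookup f \<beta> * vec_monom x \<beta>
      = Poly_Mapping.lookup f \<beta> * (mfact \<beta> / fact d) * (fact d / mfact \<beta> * vec_monom x \<beta>)"
    using mfact_pos[of \<beta>] by simp
qed

lemma peval_scale:
  fixes f :: "'n::finite mpoly_real"
  assumes "f \<in> homogeneous_polys d"
  shows "peval f (c *\<^sub>R x) = c ^ d * peval f x"
proof -
  have "vec_monom (c *\<^sub>R x) \<beta> = c ^ d * vec_monom x \<beta>" if "\<beta> \<in> multi_indices d" for \<beta> :: "nat ^ 'n"
    using that by (simp add: vec_monom_def power_mult_distrib prod.distrib multi_indices_def
        power_sum[symmetric])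
  then show ?thesis
    unfolding peval_homogeneous[OF assms] by (simp add: sum_distrib_left mult_ac)
qed

text \<open>On the simplex a form is a convex combination of its Bernstein coefficients.\<close>

lemma bernstein_coeff_le_peval:
  assumes f: "f \<in> homogeneous_polys d" and x: "x \<in> std_simplex"
    and m: "\<And>\<beta>. \<beta> \<in> multi_indices d \<Longrightarrow> m \<le> bernstein_coeff d f \<beta>"
  shows "m \<le> peval f x"
proof -
  have x': "\<And>i. 0 \<le> x $ i" "(\<Sum>i\<in>UNIV. x $ i) = 1"
    using x by (auto simp: std_simplex_def)
  have "m = (\<Sum>\<beta>\<in>multi_indices d. m * (fact d / mfact \<beta> * vec_monom x \<beta>))"
    by (simp only: sum_distrib_left[symmetric] multinomial_theorem x') simp
  also have "\<dots> \<le> peval f x"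
    unfolding peval_bernstein_form[OF f]
    by (intro sum_mono mult_right_mono m mult_nonneg_nonneg divide_nonneg_pos
        vec_monom_nonneg x' mfact_pos) auto
  finally show ?thesis .
qed

text \<open>
  Passing from falling factorials to powers adds weights that are nonnegative and have total
  \<open>r ^ d - falling_fact r d\<close>, each multiplied by a coefficient that is at most \<open>M\<close>.
\<close>

lemma peval_grid_le:
  fixes f :: "'n::finite mpoly_real"
  assumes f: "f \<in> homogeneous_polys d" and \<alpha>: "\<alpha> \<in> multi_indices r"
    and M: "\<And>\<beta>. \<beta> \<in> multi_indices d \<Longrightarrow> bernstein_coeff d f \<beta> \<le> M"
  shows "peval f (\<chi> i. real (\<alpha> $ i))
       \<le> (\<Sum>\<beta>\<in>multi_indices d. bernstein_coeff d f \<beta> * (fact d / mfact \<beta> * vec_falling \<alpha> \<beta>))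
          + (real r ^ d - falling_fact r d) * M"
proof -
  let ?y = "\<chi> i. real (\<alpha> $ i)"
  have "(\<Sum>i\<in>UNIV. ?y $ i) = real r"
    using \<alpha> unfolding multi_indices_def by (simp flip: of_nat_sum)
  then have tot: "(\<Sum>\<beta>\<in>multi_indices d. fact d / mfact \<beta> * (vec_monom ?y \<beta> - vec_falling \<alpha> \<beta>))
      = real r ^ d - falling_fact r d"
    using multinomial_theorem[of d ?y] multinomial_vandermonde[OF \<alpha>, of d]
    by (simp add: right_diff_distrib sum_subtractf)
  have "peval f ?y - (\<Sum>\<beta>\<in>multi_indices d. bernstein_coeff d f \<beta> * (fact d / mfact \<beta> * vec_falling \<alpha> \<beta>))
      = (\<Sum>\<beta>\<in>multi_indices d. bernstein_coeff d f \<beta>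
            * (fact d / mfact \<beta> * (vec_monom ?y \<beta> - vec_falling \<alpha> \<beta>)))"
    unfolding peval_bernstein_form[OF f] by (simp add: sum_subtractf right_diff_distrib)
  also have "\<dots> \<le> (\<Sum>\<beta>\<in>multi_indices d. M * (fact d / mfact \<beta> * (vec_monom ?y \<beta> - vec_falling \<alpha> \<beta>)))"
  proof (intro sum_mono mult_right_mono M mult_nonneg_nonneg divide_nonneg_pos mfact_pos)
    show "0 \<le> vec_monom ?y \<beta> - vec_falling \<alpha> \<beta>" for \<beta>
      using vec_falling_le_vec_monom[of \<alpha> \<beta>] by simp
  qed auto
  also have "\<dots> = (real r ^ d - falling_fact r d) * M"
    by (simp only: sum_distrib_left[symmetric] tot mult.commute)
  finally show ?thesis by simp
qed

lemma bernstein_approx_le: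
  fixes f :: "'n::finite mpoly_real"
  assumes r: "r \<ge> 1" and f: "f \<in> homogeneous_polys d" and x: "x \<in> std_simplex"
    and M: "\<And>\<beta>. \<beta> \<in> multi_indices d \<Longrightarrow> bernstein_coeff d f \<beta> \<le> M"
  shows "bernstein_approx r f x
       \<le> falling_fact r d / real r ^ d * peval f x + (1 - falling_fact r d / real r ^ d) * M"
proof -
  have x': "\<And>i. 0 \<le> x $ i" "(\<Sum>i\<in>UNIV. x $ i) = 1"
    using x by (auto simp: std_simplex_def)
  let ?b = "bernstein_coeff d f"
  let ?w = "\<lambda>\<alpha>. fact r / mfact \<alpha> * vec_monom x \<alpha>"
  let ?G = "\<lambda>\<alpha>. \<Sum>\<beta>\<in>multi_indices d. ?b \<beta> * (fact d / mfact \<beta> * vec_falling \<alpha> \<beta>)"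
  let ?K = "(real r ^ d - falling_fact r d) * M"
  have grid: "peval f (\<chi> i. real (\<alpha> $ i)) = real r ^ d * peval f (\<chi> i. real (\<alpha> $ i) / real r)"
    for \<alpha> :: "nat ^ 'n"
  proof -
    have "(\<chi> i. real (\<alpha> $ i)) = real r *\<^sub>R (\<chi> i. real (\<alpha> $ i) / real r)"
      using r by (simp add: vec_eq_iff)
    then show ?thesis by (simp only: peval_scale[OF f])
  qed
  have "real r ^ d * bernstein_approx r f x
      = (\<Sum>\<alpha>\<in>multi_indices r. ?w \<alpha> * peval f (\<chi> i. real (\<alpha> $ i)))"
    unfolding bernstein_approx_def grid by (simp add: sum_distrib_left mult_ac)
  also have "\<dots> \<le> (\<Sum>\<alpha>\<in>multi_indices r. ?w \<alpha> * (?G \<alpha> + ?K))"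
    by (intro sum_mono mult_left_mono peval_grid_le[OF f] M mult_nonneg_nonneg divide_nonneg_pos
        vec_monom_nonneg x' mfact_pos) auto
  also have "\<dots> = (\<Sum>\<alpha>\<in>multi_indices r. ?w \<alpha> * ?G \<alpha>) + ?K"
    by (simp only: distrib_left sum.distrib sum_distrib_right[symmetric] multinomial_theorem x') simp
  also have "(\<Sum>\<alpha>\<in>multi_indices r. ?w \<alpha> * ?G \<alpha>)
      = (\<Sum>\<beta>\<in>multi_indices d. \<Sum>\<alpha>\<in>multi_indices r. ?w \<alpha> * (?b \<beta> * (fact d / mfact \<beta> * vec_falling \<alpha> \<beta>)))"
    unfolding sum_distrib_left by (rule sum.swap)
  also have "\<dots> = (\<Sum>\<beta>\<in>multi_indices d. ?b \<beta> * (fact d / mfact \<beta>)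
      * (\<Sum>\<alpha>\<in>multi_indices r. ?w \<alpha> * vec_falling \<alpha> \<beta>))"
    by (simp add: sum_distrib_left mult_ac)
  also have "\<dots> = (\<Sum>\<beta>\<in>multi_indices d. ?b \<beta> * (fact d / mfact \<beta>)
      * (falling_fact r d * vec_monom x \<beta>))"
    by (rule sum.cong[OF refl]) (simp only: multinomial_factorial_moment[OF x'(2)])
  also have "\<dots> = falling_fact r d * peval f x"
    unfolding peval_bernstein_form[OF f] by (simp add: sum_distrib_left mult_ac)
  finally have "real r ^ d * bernstein_approx r f x \<le> falling_fact r d * peval f x + ?K" .
  then show ?thesis
    using r by (simp add: field_simps)
qed

section \<open>Bounding coefficients by values on the simplex\<close>

text \<open>
  Up to sign, the sum is the \<open>m\<close>-th finite difference of \<open>k ^ j\<close> at \<open>0\<close>. Absorbing one factor \<open>k\<close> into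
  the binomial coefficient and expanding \<open>(k + 1) ^ i\<close> reduces it to sums of order \<open>m - 1\<close>.
\<close>

lemma alternating_binomial_power_sum:
  "j \<le> m \<Longrightarrow> (\<Sum>k\<le>m. (-1) ^ k * real (m choose k) * real k ^ j)
     = (if j = m then (-1) ^ m * fact m else 0)"
proof (induction m arbitrary: j)
  case 0
  then show ?case by simp
next
  case (Suc m)
  show ?case
  proof (cases j)
    case 0
    then show ?thesis
      using choose_alternating_sum[of "Suc m", where 'a = real] by simp
  next
    case (Suc i)
    then have i: "i \<le> m" using Suc.prems by simp
    have "(\<Sum>k\<le>Suc m. (-1) ^ k * real (Suc m choose k) * real k ^ j)
        = (\<Sum>k\<le>m. (-1) ^ Suc k * real (Suc m choose Suc k) * real (Suc k) ^ Suc i)"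
      by (subst sum.atMost_Suc_shift) (simp add: Suc)
    also have "\<dots> = (\<Sum>k\<le>m. - real (Suc m) * ((-1) ^ k * real (m choose k) * real (Suc k) ^ i))"
    proof (intro sum.cong refl)
      fix k
      have absorb: "real (Suc k) * real (Suc m choose Suc k) = real (Suc m) * real (m choose k)"
        unfolding of_nat_mult[symmetric] Suc_times_binomial ..
      have "(-1) ^ Suc k * real (Suc m choose Suc k) * real (Suc k) ^ Suc i
          = - ((-1) ^ k * (real (Suc k) * real (Suc m choose Suc k)) * real (Suc k) ^ i)"
        by (simp del: binomial_Suc_Suc of_nat_Suc)
      then show "(-1) ^ Suc k * real (Suc m choose Suc k) * real (Suc k) ^ Suc i
          = - real (Suc m) * ((-1) ^ k * real (m choose k) * real (Suc k) ^ i)"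
        unfolding absorb by (simp del: binomial_Suc_Suc of_nat_Suc)
    qed
    also have "\<dots> = - real (Suc m) * (\<Sum>k\<le>m. \<Sum>l\<le>i. real (i choose l)
        * ((-1) ^ k * real (m choose k) * real k ^ l))"
      unfolding sum_distrib_left[symmetric]
      by (simp add: binomial_ring[of "real _" 1, simplified] add.commute[of 1] sum_distrib_left mult_ac)
    also have "\<dots> = - real (Suc m) * (\<Sum>l\<le>i. real (i choose l)
        * (\<Sum>k\<le>m. (-1) ^ k * real (m choose k) * real k ^ l))"
      by (subst sum.swap) (simp add: sum_distrib_left)
    also have "\<dots> = - real (Suc m) * (\<Sum>l\<le>i. if l = m then real (i choose l) * ((-1) ^ m * fact m) else 0)"
      using i by (intro arg_cong[where f = "(*) _"] sum.cong refl) (simp add: Suc.IH)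
    also have "\<dots> = (if j = Suc m then (-1) ^ Suc m * fact (Suc m) else 0)"
      using i Suc by (auto simp: algebra_simps)
    finally show ?thesis .
  qed
qed

definition vec_choose :: "nat ^ 'n \<Rightarrow> nat ^ 'n \<Rightarrow> real" where
  "vec_choose \<beta> \<gamma> = (\<Prod>i\<in>UNIV. real ((\<beta> $ i) choose (\<gamma> $ i)))"

definition sub_indices :: "nat ^ 'n \<Rightarrow> (nat ^ 'n) set" where
  "sub_indices \<beta> = {\<gamma>. \<forall>i. \<gamma> $ i \<le> \<beta> $ i}"

lemma sub_indices_eq_image:
  "sub_indices \<beta> = (\<lambda>g. \<chi> i. g i) ` (Pi\<^sub>E (UNIV :: 'n::finite set) (\<lambda>i. {..\<beta> $ i}))"
proof (intro set_eqI iffI)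
  fix \<gamma> assume "\<gamma> \<in> sub_indices \<beta>"
  then show "\<gamma> \<in> (\<lambda>g. \<chi> i. g i) ` (Pi\<^sub>E UNIV (\<lambda>i. {..\<beta> $ i}))"
    by (intro image_eqI[where x = "\<lambda>i. \<gamma> $ i"]) (auto simp: sub_indices_def)
qed (auto simp: sub_indices_def PiE_iff)

lemma finite_sub_indices: "finite (sub_indices (\<beta> :: nat ^ 'n::finite))"
  unfolding sub_indices_eq_image by (intro finite_imageI finite_PiE) auto

lemma sum_sub_indices_prod:
  fixes \<beta> :: "nat ^ 'n::finite" and q :: "'n \<Rightarrow> nat \<Rightarrow> real"
  shows "(\<Sum>\<gamma>\<in>sub_indices \<beta>. \<Prod>i\<in>UNIV. q i (\<gamma> $ i)) = (\<Prod>i\<in>UNIV. \<Sum>k\<le>\<beta> $ i. q i k)"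
proof -
  have "inj_on (\<lambda>g. \<chi> i. g i) (Pi\<^sub>E (UNIV :: 'n set) (\<lambda>i. {..\<beta> $ i}))"
    by (auto intro!: inj_onI simp: vec_eq_iff fun_eq_iff)
  then show ?thesis
    unfolding sub_indices_eq_image by (simp add: sum.reindex prod_sum_PiE)
qed

text \<open>
  The sum factors into one-dimensional differences. Two different multi-indices of the same size
  satisfy \<open>\<delta> $ i < \<beta> $ i\<close> in some coordinate, and there the difference vanishes.
\<close>

lemma mixed_difference_monomial:
  fixes \<beta> \<delta> :: "nat ^ 'n::finite"
  assumes "\<beta> \<in> multi_indices d" "\<delta> \<in> multi_indices d"
  shows "(\<Sum>\<gamma>\<in>sub_indices \<beta>. (\<Prod>i\<in>UNIV. (-1) ^ (\<gamma> $ i)) * vec_choose \<beta> \<gamma>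
            * vec_monom (\<chi> i. real (\<gamma> $ i)) \<delta>)
       = (if \<delta> = \<beta> then (-1) ^ d * mfact \<beta> else 0)"
proof -
  have "(\<Sum>\<gamma>\<in>sub_indices \<beta>. (\<Prod>i\<in>UNIV. (-1) ^ (\<gamma> $ i)) * vec_choose \<beta> \<gamma>
            * vec_monom (\<chi> i. real (\<gamma> $ i)) \<delta>)
      = (\<Prod>i\<in>UNIV. \<Sum>k\<le>\<beta> $ i. (-1) ^ k * real ((\<beta> $ i) choose k) * real k ^ (\<delta> $ i))"
    unfolding sum_sub_indices_prod[symmetric]
    by (simp add: vec_choose_def vec_monom_def prod.distrib)
  also have "\<dots> = (if \<delta> = \<beta> then (-1) ^ d * mfact \<beta> else 0)"
  proof (cases "\<delta> = \<beta>")
    case True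
    then show ?thesis
      using assms(1) by (simp add: alternating_binomial_power_sum prod.distrib mfact_def
          multi_indices_def power_sum[symmetric])
  next
    case False
    have "\<exists>i. \<delta> $ i < \<beta> $ i"
    proof (rule ccontr)
      assume "\<not> ?thesis"
      then have le: "\<And>i. \<beta> $ i \<le> \<delta> $ i" by (simp add: not_less)
      have "(\<Sum>i\<in>UNIV. \<beta> $ i) = (\<Sum>i\<in>UNIV. \<delta> $ i)"
        using assms by (simp add: multi_indices_def)
      moreover obtain i where "\<beta> $ i \<noteq> \<delta> $ i"
        using False by (metis vec_eq_iff)
      with le[of i] have "\<beta> $ i < \<delta> $ i" by simp
      then have "(\<Sum>i\<in>UNIV. \<beta> $ i) < (\<Sum>i\<in>UNIV. \<delta> $ i)"
        using le by (intro sum_strict_mono_ex1) auto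
      ultimately show False by simp
    qed
    then obtain i where "\<delta> $ i < \<beta> $ i" ..
    then have "(\<Sum>k\<le>\<beta> $ i. (-1) ^ k * real ((\<beta> $ i) choose k) * real k ^ (\<delta> $ i)) = 0"
      by (simp add: alternating_binomial_power_sum)
    with False show ?thesis
      by (auto intro!: prod_zero)
  qed
  finally show ?thesis .
qed

lemma coefficient_from_grid_values:
  fixes c :: "nat ^ 'n::finite \<Rightarrow> real"
  assumes \<beta>: "\<beta> \<in> multi_indices d"
  shows "(-1) ^ d * mfact \<beta> * c \<beta>
       = (\<Sum>\<gamma>\<in>sub_indices \<beta>. (\<Prod>i\<in>UNIV. (-1) ^ (\<gamma> $ i)) * vec_choose \<beta> \<gamma>
            * (\<Sum>\<delta>\<in>multi_indices d. c \<delta> * vec_monom (\<chi> i. real (\<gamma> $ i)) \<delta>))"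
proof -
  let ?s = "\<lambda>\<gamma>. (\<Prod>i\<in>UNIV. (-1) ^ (\<gamma> $ i)) * vec_choose \<beta> \<gamma>"
  let ?x = "\<lambda>\<gamma>. \<chi> i. real (\<gamma> $ i)"
  have "(\<Sum>\<gamma>\<in>sub_indices \<beta>. ?s \<gamma> * (\<Sum>\<delta>\<in>multi_indices d. c \<delta> * vec_monom (?x \<gamma>) \<delta>))
      = (\<Sum>\<delta>\<in>multi_indices d. \<Sum>\<gamma>\<in>sub_indices \<beta>. ?s \<gamma> * (c \<delta> * vec_monom (?x \<gamma>) \<delta>))"
    unfolding sum_distrib_left by (rule sum.swap)
  also have "\<dots> = (\<Sum>\<delta>\<in>multi_indices d. c \<delta> * (\<Sum>\<gamma>\<in>sub_indices \<beta>. ?s \<gamma> * vec_monom (?x \<gamma>) \<delta>))"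
    by (simp add: sum_distrib_left mult_ac)
  also have "\<dots> = (\<Sum>\<delta>\<in>multi_indices d. if \<delta> = \<beta> then c \<delta> * ((-1) ^ d * mfact \<beta>) else 0)"
    by (intro sum.cong refl) (simp add: mixed_difference_monomial[OF \<beta>])
  also have "\<dots> = (-1) ^ d * mfact \<beta> * c \<beta>"
    using \<beta> by (simp add: finite_multi_indices)
  finally show ?thesis ..
qed

text \<open>
  The weights have total \<open>2 ^ d\<close>. The index \<open>\<gamma> = 0\<close> contributes nothing because \<open>d\<close> is positive, and
  leaving it out is what makes the constant small enough for \<open>two_power_le_central_binomial\<close>, which
  is an equality for \<open>d = 1\<close> and \<open>d = 2\<close>.
\<close>

lemma sum_vec_choose_power_le:
  fixes \<beta> :: "nat ^ 'n::finite"
  assumes d: "d \<ge> 1" and \<beta>: "\<beta> \<in> multi_indices d"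
  shows "(\<Sum>\<gamma>\<in>sub_indices \<beta>. vec_choose \<beta> \<gamma> * real (\<Sum>i\<in>UNIV. \<gamma> $ i) ^ d) \<le> (2 ^ d - 1) * real d ^ d"
proof -
  have sum\<beta>: "(\<Sum>i\<in>UNIV. \<beta> $ i) = d"
    using \<beta> by (simp add: multi_indices_def)
  have 0: "0 \<in> sub_indices \<beta>" by (simp add: sub_indices_def)
  have "(\<Sum>\<gamma>\<in>sub_indices \<beta>. vec_choose \<beta> \<gamma>) = (\<Prod>i\<in>UNIV. \<Sum>k\<le>\<beta> $ i. real ((\<beta> $ i) choose k))"
    unfolding vec_choose_def by (rule sum_sub_indices_prod)
  also have "\<dots> = 2 ^ d"
    using sum\<beta> by (simp flip: of_nat_sum power_sum add: choose_row_sum)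
  finally have total: "(\<Sum>\<gamma>\<in>sub_indices \<beta> - {0}. vec_choose \<beta> \<gamma>) = 2 ^ d - 1"
    using 0 by (simp add: sum.remove[OF finite_sub_indices 0] vec_choose_def)
  have "(\<Sum>\<gamma>\<in>sub_indices \<beta>. vec_choose \<beta> \<gamma> * real (\<Sum>i\<in>UNIV. \<gamma> $ i) ^ d)
      = (\<Sum>\<gamma>\<in>sub_indices \<beta> - {0}. vec_choose \<beta> \<gamma> * real (\<Sum>i\<in>UNIV. \<gamma> $ i) ^ d)"
    using d by (intro sum.mono_neutral_right) (auto simp: finite_sub_indices)
  also have "\<dots> \<le> (\<Sum>\<gamma>\<in>sub_indices \<beta> - {0}. vec_choose \<beta> \<gamma> * real d ^ d)"
  proof (intro sum_mono mult_left_mono power_mono)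
    fix \<gamma> assume "\<gamma> \<in> sub_indices \<beta> - {0}"
    then have "(\<Sum>i\<in>UNIV. \<gamma> $ i) \<le> (\<Sum>i\<in>UNIV. \<beta> $ i)"
      by (intro sum_mono) (auto simp: sub_indices_def)
    then show "real (\<Sum>i\<in>UNIV. \<gamma> $ i) \<le> real d" by (simp only: sum\<beta> of_nat_le_iff)
    show "0 \<le> vec_choose \<beta> \<gamma>" unfolding vec_choose_def by (intro prod_nonneg) simp
  qed (simp add: sum_nonneg)
  also have "\<dots> = (2 ^ d - 1) * real d ^ d"
    by (simp only: sum_distrib_right[symmetric] total)
  finally show ?thesis .
qed

text \<open>
  The binomial coefficient for \<open>d + 1\<close> is twice the one for \<open>d\<close> plus a positive term of Pascal's rule,
  while \<open>2 ^ d - 1\<close> is doubled and increased by exactly one.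
\<close>

lemma two_power_le_central_binomial: "d \<ge> 1 \<Longrightarrow> 2 ^ d \<le> ((2 * d - 1) choose d) + 1"
proof (induction d rule: nat_induct_at_least)
  case base
  then show ?case by simp
next
  case (Suc d)
  then obtain e where e: "d = Suc e" by (cases d) auto
  have "(2 * e + 1) choose (Suc e) = (2 * e + 1) choose e"
    using binomial_symmetric[of "Suc e" "2 * e + 1"] by simp
  then have "(2 * d) choose d = 2 * ((2 * d - 1) choose d)"
    by (simp add: e)
  moreover have "(2 * Suc d - 1) choose Suc d = ((2 * d) choose d) + ((2 * d) choose Suc d)"
    by simp
  moreover have "0 < (2 * d) choose Suc d"
    using Suc.hyps by (simp add: zero_less_binomial_iff)
  ultimately show ?case unfolding power_Suc using Suc.IH by linarith
qed

text \<open>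
  A nonzero integer point is a multiple of a point of the simplex, so homogeneity carries a bound on
  the simplex over to it; at the origin both sides vanish.
\<close>

lemma peval_grid_bounds:
  fixes f :: "'n::finite mpoly_real" and \<gamma> :: "nat ^ 'n"
  assumes d: "d \<ge> 1" and f: "f \<in> homogeneous_polys d"
    and bounds: "\<And>x. x \<in> std_simplex \<Longrightarrow> \<bar>peval f x - c\<bar> \<le> R"
  shows "\<bar>peval f (\<chi> i. real (\<gamma> $ i)) - c * real (\<Sum>i\<in>UNIV. \<gamma> $ i) ^ d\<bar>
       \<le> R * real (\<Sum>i\<in>UNIV. \<gamma> $ i) ^ d"
proof -
  let ?y = "\<chi> i. real (\<gamma> $ i)"
  define t where "t = real (\<Sum>i\<in>UNIV. \<gamma> $ i)"
  show ?thesis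
  proof (cases "t = 0")
    case True
    then have "?y = 0 *\<^sub>R ?y" by (auto simp: vec_eq_iff t_def simp del: of_nat_sum)
    then have "peval f ?y = 0 ^ d * peval f ?y" by (metis peval_scale[OF f])
    then show ?thesis using d True by (simp add: t_def power_0_left)
  next
    case False
    have "0 \<le> t" by (simp add: t_def sum_nonneg)
    with False have t: "t > 0" by simp
    have "(\<chi> i. real (\<gamma> $ i) / t) \<in> std_simplex"
      using t by (auto simp: std_simplex_def sum_divide_distrib[symmetric] t_def)
    from bounds[OF this] have "t ^ d * \<bar>peval f (\<chi> i. real (\<gamma> $ i) / t) - c\<bar> \<le> t ^ d * R"
      using t by (intro mult_left_mono) auto
    moreover have "?y = t *\<^sub>R (\<chi> i. real (\<gamma> $ i) / t)"
      using t by (simp add: vec_eq_iff)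
    then have "peval f ?y = t ^ d * peval f (\<chi> i. real (\<gamma> $ i) / t)"
      by (simp only: peval_scale[OF f])
    moreover have "t ^ d * \<bar>z\<bar> = \<bar>t ^ d * z\<bar>" for z
      using t by (simp add: abs_mult)
    ultimately show ?thesis by (simp add: t_def[symmetric] algebra_simps del: of_nat_sum)
  qed
qed

text \<open>
  The form \<open>c (\<Sum>i. x $ i) ^ d\<close> has all its Bernstein coefficients equal to \<open>c\<close> and is \<open>c\<close> on the
  simplex. Subtracting it leaves a form that is bounded by \<open>R\<close> there, whose coefficients are then
  recovered from its values at integer points.
\<close>

lemma bernstein_coeff_deviation:
  fixes f :: "'n::finite mpoly_real"
  assumes d: "d \<ge> 1" and f: "f \<in> homogeneous_polys d" and \<beta>: "\<beta> \<in> multi_indices d"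
    and bounds: "\<And>x. x \<in> std_simplex \<Longrightarrow> \<bar>peval f x - c\<bar> \<le> R"
  shows "\<bar>bernstein_coeff d f \<beta> - c\<bar> \<le> real ((2 * d - 1) choose d) * real d ^ d * R"
proof -
  \<comment> \<open>the monomial coefficients of \<open>f - c (\<Sum>i. x $ i) ^ d\<close>\<close>
  let ?a = "\<lambda>\<delta>. Poly_Mapping.lookup f \<delta> - c * (fact d / mfact \<delta>)"
  let ?t = "\<lambda>\<gamma> :: nat ^ 'n. real (\<Sum>i\<in>UNIV. \<gamma> $ i)"
  let ?y = "\<lambda>\<gamma>. \<chi> i. real (\<gamma> $ i)"
  obtain z :: "real ^ 'n" where "z \<in> std_simplex" using std_simplex_nonempty by blast
  then have R: "0 \<le> R" using bounds[of z] by linarith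
  have val: "(\<Sum>\<delta>\<in>multi_indices d. ?a \<delta> * vec_monom (?y \<gamma>) \<delta>) = peval f (?y \<gamma>) - c * ?t \<gamma> ^ d"
    for \<gamma> :: "nat ^ 'n"
  proof -
    have "(\<Sum>\<delta>\<in>multi_indices d. c * (fact d / mfact \<delta>) * vec_monom (?y \<gamma>) \<delta>) = c * ?t \<gamma> ^ d"
      by (simp only: mult.assoc sum_distrib_left[symmetric] multinomial_theorem) simp
    then show ?thesis
      by (simp only: peval_homogeneous[OF f] left_diff_distrib sum_subtractf)
  qed
  have eq: "fact d * (bernstein_coeff d f \<beta> - c) = mfact \<beta> * ?a \<beta>"
    using mfact_pos[of \<beta>] by (simp add: bernstein_coeff_def field_simps)
  have "fact d * \<bar>bernstein_coeff d f \<beta> - c\<bar> = \<bar>fact d * (bernstein_coeff d f \<beta> - c)\<bar>"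
    by (simp add: abs_mult)
  also have "\<dots> = \<bar>(-1) ^ d * mfact \<beta> * ?a \<beta>\<bar>"
    unfolding eq by (simp add: abs_mult)
  also have "\<dots> = \<bar>\<Sum>\<gamma>\<in>sub_indices \<beta>. (\<Prod>i\<in>UNIV. (-1) ^ (\<gamma> $ i)) * vec_choose \<beta> \<gamma>
      * (peval f (?y \<gamma>) - c * ?t \<gamma> ^ d)\<bar>"
    by (subst coefficient_from_grid_values[OF \<beta>]) (simp only: val)
  also have "\<dots> \<le> (\<Sum>\<gamma>\<in>sub_indices \<beta>. vec_choose \<beta> \<gamma> * (R * ?t \<gamma> ^ d))"
  proof (rule order.trans[OF sum_abs], intro sum_mono)
    fix \<gamma> :: "nat ^ 'n"
    have nn: "0 \<le> vec_choose \<beta> \<gamma>" unfolding vec_choose_def by (intro prod_nonneg) simp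
    have "\<bar>(\<Prod>i\<in>UNIV. (-1) ^ (\<gamma> $ i)) * vec_choose \<beta> \<gamma> * (peval f (?y \<gamma>) - c * ?t \<gamma> ^ d)\<bar>
        = vec_choose \<beta> \<gamma> * \<bar>peval f (?y \<gamma>) - c * ?t \<gamma> ^ d\<bar>"
      using nn by (simp add: abs_mult abs_prod)
    also have "\<dots> \<le> vec_choose \<beta> \<gamma> * (R * ?t \<gamma> ^ d)"
      by (intro mult_left_mono peval_grid_bounds[OF d f bounds] nn)
    finally show "\<bar>(\<Prod>i\<in>UNIV. (-1) ^ (\<gamma> $ i)) * vec_choose \<beta> \<gamma> * (peval f (?y \<gamma>) - c * ?t \<gamma> ^ d)\<bar>
        \<le> vec_choose \<beta> \<gamma> * (R * ?t \<gamma> ^ d)" .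
  qed
  also have "\<dots> = R * (\<Sum>\<gamma>\<in>sub_indices \<beta>. vec_choose \<beta> \<gamma> * ?t \<gamma> ^ d)"
    by (simp add: sum_distrib_left mult_ac)
  also have "\<dots> \<le> R * ((2 ^ d - 1) * real d ^ d)"
    by (intro mult_left_mono sum_vec_choose_power_le[OF d \<beta>] R)
  also have "\<dots> \<le> R * (real ((2 * d - 1) choose d) * real d ^ d)"
  proof (intro mult_left_mono mult_right_mono R)
    have "real (2 ^ d) \<le> real (((2 * d - 1) choose d) + 1)"
      using two_power_le_central_binomial[OF d] by (rule of_nat_mono)
    then show "2 ^ d - 1 \<le> real ((2 * d - 1) choose d)" by simp
  qed simp
  finally have "fact d * \<bar>bernstein_coeff d f \<beta> - c\<bar> \<le> R * (real ((2 * d - 1) choose d) * real d ^ d)" .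
  moreover have "1 * \<bar>bernstein_coeff d f \<beta> - c\<bar> \<le> fact d * \<bar>bernstein_coeff d f \<beta> - c\<bar>"
    by (intro mult_right_mono fact_ge_1) simp
  ultimately show ?thesis by (simp add: mult_ac)
qed

section \<open>The error in terms of the range on the simplex\<close>

theorem theorem8:
  fixes f :: "'n::finite mpoly_real" and d r :: nat
  assumes "d \<ge> 1" and "r \<ge> 1"
    and "f \<in> homogeneous_polys d"
  shows
    "simplex_max (\<lambda>x. bernstein_approx r f x - peval f x)
       \<le> (1 - falling_fact r d / real r ^ d)
           * (Max ((\<lambda>\<beta>. Poly_Mapping.lookup f \<beta> * (mfact \<beta> / fact d)) ` multi_indices d)
              - Min ((\<lambda>\<beta>. Poly_Mapping.lookup f \<beta> * (mfact \<beta> / fact d)) ` multi_indices d))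
     \<and> (1 - falling_fact r d / real r ^ d)
           * (Max ((\<lambda>\<beta>. Poly_Mapping.lookup f \<beta> * (mfact \<beta> / fact d)) ` multi_indices d)
              - Min ((\<lambda>\<beta>. Poly_Mapping.lookup f \<beta> * (mfact \<beta> / fact d)) ` multi_indices d))
       \<le> (1 - falling_fact r d / real r ^ d) * real ((2 * d - 1) choose d) * real d ^ d
           * (simplex_max (peval f) - simplex_min (peval f))"
proof -
  note d = assms(1) and r = assms(2) and f = assms(3)
  let ?b = "bernstein_coeff d f"
  let ?B = "?b ` multi_indices d"
  let ?q = "1 - falling_fact r d / real r ^ d"
  let ?C = "real ((2 * d - 1) choose d) * real d ^ d"
  have fin: "finite ?B" "?B \<noteq> {}"
    by (simp_all add: finite_multi_indices multi_indices_nonempty)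
  have q: "0 \<le> ?q"
    using r falling_fact_le_power[of r d] by (simp add: divide_le_eq)

  have "continuous_on std_simplex (\<lambda>x. bernstein_approx r f x - peval f x)"
    by (intro continuous_intros)
  from simplex_max_attained[OF this] obtain x where x: "x \<in> std_simplex"
    "bernstein_approx r f x - peval f x = simplex_max (\<lambda>x. bernstein_approx r f x - peval f x)"
    by blast
  have "bernstein_approx r f x \<le> (1 - ?q) * peval f x + ?q * Max ?B"
    using bernstein_approx_le[OF r f x(1), of "Max ?B"] fin by simp
  then have "bernstein_approx r f x - peval f x \<le> ?q * (Max ?B - peval f x)"
    by (simp add: algebra_simps)
  also have "\<dots> \<le> ?q * (Max ?B - Min ?B)"
  proof (rule mult_left_mono[OF _ q])
    have "Min ?B \<le> peval f x"
      by (rule bernstein_coeff_le_peval[OF f x(1)]) (use fin in simp)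
    then show "Max ?B - peval f x \<le> Max ?B - Min ?B" by linarith
  qed
  finally have first: "simplex_max (\<lambda>x. bernstein_approx r f x - peval f x) \<le> ?q * (Max ?B - Min ?B)"
    by (simp add: x(2))

  \<comment> \<open>Measuring from the midpoint of the range bounds the largest and the smallest coefficient by
    half of the range each, so no factor \<open>2\<close> is lost.\<close>
  let ?M = "simplex_max (peval f)" and ?m = "simplex_min (peval f)"
  have "\<bar>peval f y - (?M + ?m) / 2\<bar> \<le> (?M - ?m) / 2" if y: "y \<in> std_simplex" for y
  proof -
    have "peval f y \<le> ?M"
      using simplex_max_attained[OF continuous_on_peval] y by metis
    moreover have "?m \<le> peval f y"
      using simplex_min_attained[OF continuous_on_peval] y by metis
    ultimately show ?thesis by (simp add: abs_le_iff field_simps)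
  qed
  note dev = bernstein_coeff_deviation[OF d f _ this]
  obtain \<beta> where \<beta>: "\<beta> \<in> multi_indices d" "Max ?B = ?b \<beta>" using Max_in[OF fin] by auto
  obtain \<gamma> where \<gamma>: "\<gamma> \<in> multi_indices d" "Min ?B = ?b \<gamma>" using Min_in[OF fin] by auto
  have "Max ?B - Min ?B \<le> ?C * ((?M - ?m) / 2) + ?C * ((?M - ?m) / 2)"
    using dev[OF \<beta>(1)] dev[OF \<gamma>(1)] unfolding \<beta>(2) \<gamma>(2) by linarith
  also have "\<dots> = ?C * (?M - ?m)" by (simp add: field_simps)
  finally have "?q * (Max ?B - Min ?B) \<le> ?q * (?C * (?M - ?m))"
    by (intro mult_left_mono q)
  with first show ?thesis
    unfolding bernstein_coeff_def by (simp only: mult.assoc simp_thms)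
qed

end
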